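(* Let $K\ge2$ be an integer and let $a,b,c\in\mathbb{C}$ with $c\notin\{0,-1,-2,\ldots\}$, $\operatorname{Re}(c-a-b)>-1$, $a\ne2$ and $b\neq2$. Then $$\sum_{n=0}^{\infty}\frac{(a)_n(b)_n}{(c)_n n!}\left(\frac{1}{(n+2)^K}-\sum_{s=0}^{K-2}\frac{(-1)^s r_{1,s}}{(n+1)^{K-s}}\right)=(-1)^{K-1}\left\{r_{1,K-1}\,A_{0,1}^{(1)}(a,b,c)+\frac{\Gamma(c)\Gamma(c-a-b+1)}{\Gamma(c-a)\Gamma(c-b)}\,t_{1,1,K-1}\right\}.$$
   Context: Notation: $(u)_0=1$, $(u)_n=u(u+1)\cdots(u+n-1)$; $1/\Gamma(z)=0$ at non-positive integers $z$; $$A_{0,1}^{(1)}(a,b,c)=\sum_{n=0}^{\infty}\frac{(a)_n(b)_n}{(c)_n n!}\frac{1}{n+1}.$$ The numbers $r_{1,s}$ and $t_{1,1,s}$ are the Taylor coefficients at $\lambda=0$ in $$\frac{(1+\lambda)(2-c+\lambda)}{(2-a+\lambda)(2-b+\lambda)}=\sum_{s\ge0}r_{1,s}\lambda^s,\qquad \frac{1}{(2-a+\lambda)(2-b+\lambda)}=\sum_{s\ge0}t_{1,1,s}\lambda^s .$$ *)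

theory Defs
  imports "HOL-Complex_Analysis.Complex_Analysis"
begin

definition hyp_coeff :: "complex \<Rightarrow> complex \<Rightarrow> complex \<Rightarrow> nat \<Rightarrow> complex" where
  "hyp_coeff a b c n = pochhammer a n * pochhammer b n / (pochhammer c n * fact n)"

text \<open>The series \<open>A\<^sub>0\<^sub>,\<^sub>1\<^sup>(\<^sup>1\<^sup>)(a,b,c)\<close>; it converges for \<open>Re (c - a - b) > -1\<close>.\<close>

definition A01 :: "complex \<Rightarrow> complex \<Rightarrow> complex \<Rightarrow> complex" where
  "A01 a b c = (\<Sum>n. hyp_coeff a b c n * (1 / (of_nat n + 1)))"

text \<open>
  \<open>r1 a b c s\<close> and \<open>t11 a b s\<close> stand for \<open>r\<^sub>1\<^sub>,\<^sub>s\<close> and \<open>t\<^sub>1\<^sub>,\<^sub>1\<^sub>,\<^sub>s\<close>.  They are Taylor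
  coefficients of the given functions only if \<open>a \<noteq> 2\<close> and \<open>b \<noteq> 2\<close>, so that the functions
  are holomorphic at \<open>0\<close>.
\<close>

definition r1 :: "complex \<Rightarrow> complex \<Rightarrow> complex \<Rightarrow> nat \<Rightarrow> complex" where
  "r1 a b c s =
     fps_nth (fps_expansion (\<lambda>l. (1 + l) * (2 - c + l) / ((2 - a + l) * (2 - b + l))) 0) s"

definition t11 :: "complex \<Rightarrow> complex \<Rightarrow> nat \<Rightarrow> complex" where
  "t11 a b s = fps_nth (fps_expansion (\<lambda>l. 1 / ((2 - a + l) * (2 - b + l))) 0) s"

end

theory Submission
  imports Defs
begin

text \<open>
  Write \<open>C n\<close> for the coefficient \<open>hyp_coeff a b c n\<close>.  The formula is the coefficient of
  \<open>\<lambda>^(K-1)\<close> in one identity of power series in \<open>\<lambda>\<close>.  Since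
  \<open>C (n+1) (c+n) (n+1) = C n (a+n) (b+n)\<close>, partial fractions in \<open>n\<close> give
  \[ \Delta_n \frac{C_n\, n (c+n-1)}{n+1+\lambda}
     = C_n \Big( \frac{(2-a+\lambda)(2-b+\lambda)}{n+2+\lambda}
                 - \frac{(1+\lambda)(2-c+\lambda)}{n+1+\lambda} - (c-a-b) \Big). \]
  After division by \<open>(2-a+\<lambda>)(2-b+\<lambda>)\<close> the two generating functions \<open>r(\<lambda>)\<close> and \<open>t(\<lambda>)\<close> of the
  statement appear, and
  \<open>C n (1/(n+2+\<lambda>) - r(\<lambda>)/(n+1+\<lambda>))\<close> is a difference plus \<open>(c-a-b) t(\<lambda>) C n\<close>
  (lemma \<open>recip_telescope\<close>).

  If \<open>Re (c-a-b) > 0\<close>, summation over \<open>n\<close> kills the difference and Gauss' theorem evaluates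
  \<open>\<Sum>n. C n\<close>.  For \<open>-1 < Re (c-a-b) \<le> 0\<close> in general neither piece converges alone, but the
  \<open>N\<close>-th partial sum of \<open>(c-a-b) C n\<close> plus \<open>N C N\<close> still tends to the Gamma quotient: by a
  contiguous relation it is a multiple of the partial sum for \<open>c + 1\<close>, to which Gauss' theorem
  applies (lemma \<open>regularised_gauss\<close>).  What is left of the boundary term is \<open>C N\<close> times a
  convergent sequence (lemma \<open>boundary_term_convergent\<close>), and \<open>C N\<close> tends to \<open>0\<close> because it is
  at most of order \<open>N powr (Re (a+b-c) - 1)\<close>.

  Gauss' theorem itself follows from the same contiguous relation, iterated \<open>c \<rightarrow> c + m\<close>: the
  accumulated factors are partial Gamma products, and the series for \<open>c + m\<close> tends to \<open>1\<close>.
\<close>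

section \<open>Recurrences and growth of the hypergeometric coefficients\<close>

lemma hyp_coeff_0 [simp]: "hyp_coeff a b c 0 = 1"
  by (simp add: hyp_coeff_def)

lemma add_of_nat_neq_0:
  assumes "c \<notin> \<int>\<^sub>\<le>\<^sub>0"
  shows "c + of_nat n \<noteq> (0::complex)"
proof
  assume "c + of_nat n = 0"
  hence "c = - of_nat n" by (simp add: eq_neg_iff_add_eq_0)
  with assms show False by simp
qed

lemma hyp_coeff_Suc:
  assumes "c \<notin> \<int>\<^sub>\<le>\<^sub>0"
  shows "(c + of_nat n) * (of_nat n + 1) * hyp_coeff a b c (Suc n)
           = (a + of_nat n) * (b + of_nat n) * hyp_coeff a b c n"
proof -
  have "hyp_coeff a b c (Suc n) = hyp_coeff a b c n *
          ((a + of_nat n) * (b + of_nat n) / ((c + of_nat n) * (of_nat n + 1)))"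
    by (simp add: hyp_coeff_def pochhammer_Suc mult_ac add.commute)
  moreover have "of_nat n + 1 \<noteq> (0::complex)" using of_nat_neq_0[of n] by (simp add: add.commute)
  ultimately show ?thesis using add_of_nat_neq_0[OF assms, of n]
    by simp
qed

lemma hyp_coeff_raise:
  assumes "c \<notin> \<int>\<^sub>\<le>\<^sub>0"
  shows "(c + of_nat n) * hyp_coeff a b (c + 1) n = c * hyp_coeff a b c n"
proof -
  have "c + 1 \<notin> \<int>\<^sub>\<le>\<^sub>0"
    using assms plus_one_in_nonpos_Ints_imp by blast
  hence "pochhammer (c+1) n \<noteq> 0" "pochhammer c n \<noteq> 0"
    using assms by (auto simp: pochhammer_eq_0_iff)
  moreover have "c * pochhammer (c+1) n = pochhammer c n * (c + of_nat n)"
    by (metis pochhammer_rec pochhammer_Suc)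
  ultimately show ?thesis
    by (simp add: hyp_coeff_def frac_eq_eq)
qed

text \<open>
  Each Pochhammer symbol is, up to a factorial and a power of \<open>n\<close>, a term of the sequence
  \<open>rGamma_series\<close> converging to the reciprocal Gamma function; the factorials cancel.
\<close>

lemma hyp_coeff_asymp:
  assumes "c \<notin> \<int>\<^sub>\<le>\<^sub>0"
  shows "(\<lambda>n. hyp_coeff a b c n * of_nat n * exp ((c - a - b) * of_real (ln (of_nat n))))
           \<longlonglongrightarrow> rGamma a * rGamma b / rGamma c"
proof -
  have nz: "eventually (\<lambda>n. z + of_nat n \<noteq> 0) sequentially" for z :: complex
  proof (cases "\<exists>m. z = - of_nat m")
    case True
    then obtain m where "z = - of_nat m" by blast
    thus ?thesis using eventually_gt_at_top[of m]
      by (auto elim!: eventually_mono)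
  next
    case False
    thus ?thesis by (auto simp: add_eq_0_iff2)
  qed
  have q: "(\<lambda>n. of_nat n / (z + of_nat n)) \<longlonglongrightarrow> 1" for z :: complex
  proof -
    have "(\<lambda>n. 1 / (1 + z * inverse (of_nat n))) \<longlonglongrightarrow> 1 / (1 + z * 0)"
      by (intro tendsto_intros lim_inverse_n) auto
    moreover have "eventually (\<lambda>n. 1 / (1 + z * inverse (of_nat n)) = of_nat n / (z + of_nat n)) sequentially"
      using eventually_gt_at_top[of 0] by eventually_elim (simp add: divide_simps add.commute)
    ultimately show ?thesis by (simp add: tendsto_cong)
  qed
  have "rGamma c \<noteq> 0" using assms by (simp add: rGamma_eq_zero_iff)
  hence "(\<lambda>n. rGamma_series a n * rGamma_series b n / rGamma_series c n *
           ((of_nat n / (a + of_nat n)) * (of_nat n / (b + of_nat n)) / (of_nat n / (c + of_nat n))))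
         \<longlonglongrightarrow> rGamma a * rGamma b / rGamma c * (1 * 1 / 1)"
    by (intro tendsto_intros q) auto
  moreover have "eventually (\<lambda>n. rGamma_series a n * rGamma_series b n / rGamma_series c n *
           ((of_nat n / (a + of_nat n)) * (of_nat n / (b + of_nat n)) / (of_nat n / (c + of_nat n)))
         = hyp_coeff a b c n * of_nat n * exp ((c - a - b) * of_real (ln (of_nat n)))) sequentially"
    using nz[of a] nz[of b] eventually_gt_at_top[of 0]
  proof eventually_elim
    \<comment> \<open>\<open>rGamma_series z n\<close> contains \<open>pochhammer z (n + 1)\<close>; the quotients \<open>n / (z + n)\<close> remove the
        surplus last factors.\<close>
    case (elim n)
    have "pochhammer c n \<noteq> 0" using assms by (auto simp: pochhammer_eq_0_iff)
    moreover have "exp ((c - a - b) * complex_of_real (ln (of_nat n)))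
        = exp (c * of_real (ln (of_nat n))) / (exp (a * of_real (ln (of_nat n))) * exp (b * of_real (ln (of_nat n))))"
      by (simp add: left_diff_distrib exp_diff)
    ultimately show ?case using elim add_of_nat_neq_0[OF assms, of n]
      by (simp add: rGamma_series_def hyp_coeff_def pochhammer_Suc divide_simps)
  qed
  ultimately show ?thesis by (simp add: tendsto_cong)
qed

lemma hyp_coeff_bigo:
  assumes "c \<notin> \<int>\<^sub>\<le>\<^sub>0"
  shows "(\<lambda>n. norm (hyp_coeff a b c n)) \<in> O(\<lambda>n. real n powr (Re (a + b - c) - 1))"
proof -
  let ?X = "\<lambda>n. hyp_coeff a b c n * of_nat n * exp ((c - a - b) * of_real (ln (of_nat n)))"
  have "Bseq ?X" using hyp_coeff_asymp[OF assms] by (intro convergent_imp_Bseq) (auto simp: convergent_def)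
  then obtain B where B: "\<And>n. norm (?X n) \<le> B" by (auto simp: Bseq_def)
  show ?thesis
  proof (rule bigoI[of _ B])
    show "\<forall>\<^sub>F n in sequentially. norm (norm (hyp_coeff a b c n)) \<le> B * norm (real n powr (Re (a + b - c) - 1))"
      using eventually_gt_at_top[of 0]
    proof eventually_elim
      case (elim n)
      have "norm (?X n) * real n powr (Re (a + b - c) - 1) = norm (hyp_coeff a b c n)"
        using elim by (simp add: norm_mult powr_def flip: exp_add)
          (simp add: algebra_simps exp_diff exp_add exp_minus)
      moreover have "norm (?X n) * real n powr (Re (a + b - c) - 1) \<le> B * real n powr (Re (a + b - c) - 1)"
        by (intro mult_right_mono B) auto
      ultimately show ?case by simp
    qed
  qed
qed

lemma hyp_coeff_summable_norm:
  assumes "c \<notin> \<int>\<^sub>\<le>\<^sub>0" "Re (c - a - b) > 0"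
  shows "summable (\<lambda>n. norm (hyp_coeff a b c n))"
proof (rule summable_comparison_test_bigo[OF _ hyp_coeff_bigo[OF assms(1)]])
  show "summable (\<lambda>n. norm (real n powr (Re (a + b - c) - 1)))"
    using assms(2) by (simp add: summable_real_powr_iff)
qed

lemma hyp_coeff_summable_div:
  assumes "c \<notin> \<int>\<^sub>\<le>\<^sub>0" "Re (c - a - b) > -1"
  shows "summable (\<lambda>n. hyp_coeff a b c n * (1 / (of_nat n + 1)))"
proof (rule summable_norm_cancel, rule summable_comparison_test_bigo)
  show "summable (\<lambda>n. norm (real n powr (Re (a + b - c) - 1 + - 1)))"
    using assms(2) by (simp add: summable_real_powr_iff)
  have nrm: "norm (1 / (of_nat n + 1 :: complex)) = 1 / (real n + 1)" for n
    by (metis norm_divide norm_one norm_of_nat of_nat_Suc add.commute)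
  have "(\<lambda>n. norm (1 / (of_nat n + 1 :: complex))) \<in> O(\<lambda>n. real n powr - 1)"
  proof (rule bigoI[of _ 1])
    show "\<forall>\<^sub>F n in sequentially. norm (norm (1 / (of_nat n + 1 :: complex))) \<le> 1 * norm (real n powr - 1)"
      using eventually_gt_at_top[of 0]
      unfolding nrm by eventually_elim (simp add: powr_minus field_simps)
  qed
  from landau_o.big.mult[OF hyp_coeff_bigo[OF assms(1), of a b] this]
  show "(\<lambda>n. norm (hyp_coeff a b c n * (1 / (of_nat n + 1))))
          \<in> O(\<lambda>n. real n powr (Re (a + b - c) - 1 + - 1))"
    unfolding norm_mult powr_add .
qed

lemma hyp_coeff_tendsto_0:
  assumes "c \<notin> \<int>\<^sub>\<le>\<^sub>0" "Re (c - a - b) > -1"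
  shows "hyp_coeff a b c \<longlonglongrightarrow> 0"
proof (rule tendsto_norm_zero_cancel)
  have "(\<lambda>n. real n powr (Re (a + b - c) - 1)) \<longlonglongrightarrow> 0"
    using assms(2) by (intro tendsto_neg_powr filterlim_real_sequentially) auto
  hence "(\<lambda>n. real n powr (Re (a + b - c) - 1)) \<in> o(\<lambda>_. 1 :: real)"
    by (intro smalloI_tendsto) auto
  from landau_o.big_small_trans[OF hyp_coeff_bigo[OF assms(1)] this]
  show "(\<lambda>n. norm (hyp_coeff a b c n)) \<longlonglongrightarrow> 0"
    using smalloD_tendsto by fastforce
qed

lemma of_nat_hyp_coeff_tendsto_0:
  assumes "c \<notin> \<int>\<^sub>\<le>\<^sub>0" "Re (c - a - b) > 0"
  shows "(\<lambda>n. of_nat n * hyp_coeff a b c n) \<longlonglongrightarrow> 0"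
proof -
  let ?L = "\<lambda>n. complex_of_real (ln (of_nat n))"
  have "(\<lambda>n. real n powr Re (a + b - c)) \<longlonglongrightarrow> 0"
    using assms(2) by (intro tendsto_neg_powr filterlim_real_sequentially) auto
  moreover have "eventually (\<lambda>n. real n powr Re (a + b - c) = norm (exp ((a + b - c) * ?L n))) sequentially"
    using eventually_gt_at_top[of 0] by eventually_elim (simp add: powr_def mult.commute)
  ultimately have "(\<lambda>n. norm (exp ((a + b - c) * ?L n))) \<longlonglongrightarrow> 0"
    by (rule Lim_transform_eventually)
  hence "(\<lambda>n. exp ((a + b - c) * ?L n)) \<longlonglongrightarrow> 0"
    by (rule tendsto_norm_zero_cancel)
  from tendsto_mult[OF hyp_coeff_asymp[OF assms(1), of a b] this]
  have "(\<lambda>n. hyp_coeff a b c n * of_nat n * (exp ((c - a - b) * ?L n) * exp ((a + b - c) * ?L n))) \<longlonglongrightarrow> 0"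
    by (simp add: mult.assoc)
  moreover have "exp ((c - a - b) * z) * exp ((a + b - c) * z) = 1" for z :: complex
    by (simp add: algebra_simps flip: exp_add)
  ultimately show ?thesis by (simp add: mult.commute)
qed

section \<open>Gauss' summation theorem\<close>

text \<open>
  The summands on the two sides differ by \<open>c ((n+1) C (n+1) - n C n)\<close>, so Gauss' contiguous
  relation between \<open>c\<close> and \<open>c + 1\<close> already holds for partial sums, with a boundary term.  This
  form is meaningful where the series for \<open>c\<close> diverges.
\<close>

lemma hyp_coeff_contiguous:
  assumes "c \<notin> \<int>\<^sub>\<le>\<^sub>0"
  shows "c * (c - a - b) * (\<Sum>n<N. hyp_coeff a b c n)
       = (c - a) * (c - b) * (\<Sum>n<N. hyp_coeff a b (c + 1) n) - c * of_nat N * hyp_coeff a b c N"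
proof (induction N)
  case (Suc N)
  let ?C = "hyp_coeff a b c" and ?D = "hyp_coeff a b (c + 1)"
  have nz: "c + of_nat N \<noteq> 0" by (rule add_of_nat_neq_0) fact
  have eq: "(c + of_nat N) * (c * (c - a - b) * ?C N)
      = (c + of_nat N) * ((c - a) * (c - b) * ?D N - c * (of_nat N + 1) * ?C (Suc N) + c * of_nat N * ?C N)"
    using hyp_coeff_Suc[OF assms, of N a b] hyp_coeff_raise[OF assms, of N a b]
    by algebra
  hence "c * (c - a - b) * ?C N
      = (c - a) * (c - b) * ?D N - c * (of_nat N + 1) * ?C (Suc N) + c * of_nat N * ?C N"
    using nz by (simp only: mult_cancel_left) auto
  thus ?case using Suc.IH unfolding sum.lessThan_Suc of_nat_Suc by algebra
qed auto

lemma norm_pochhammer_ge: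
  assumes "0 < x" "x \<le> Re w"
  shows "pochhammer x k \<le> norm (pochhammer w k)"
proof (induction k)
  case (Suc k)
  have "x + real k \<le> Re (w + of_nat k)" using assms by simp
  also have "\<dots> \<le> norm (w + of_nat k)" by (rule complex_Re_le_cmod)
  finally show ?case using Suc assms
    by (auto simp: pochhammer_Suc norm_mult intro!: mult_mono)
qed auto

lemma hyp_coeff_shift_tendsto:
  "(\<lambda>m. hyp_coeff a b (c + of_nat m) k) \<longlonglongrightarrow> (if k = 0 then 1 else 0)"
proof (cases k)
  case (Suc j)
  have c: "filterlim (\<lambda>m. pochhammer (c + of_nat m) k) at_infinity sequentially"
  proof (rule filterlim_norm_at_top_imp_at_infinity)
    have lim: "filterlim (\<lambda>m. Re c + real m) at_top sequentially"
      by (intro filterlim_tendsto_add_at_top[OF tendsto_const] filterlim_real_sequentially)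
    show "filterlim (\<lambda>m. norm (pochhammer (c + of_nat m) k)) at_top sequentially"
    proof (rule filterlim_at_top_mono[OF lim])
      show "\<forall>\<^sub>F m in sequentially. Re c + real m \<le> norm (pochhammer (c + of_nat m) k)"
        using lim[unfolded filterlim_at_top, rule_format, of 1]
      proof eventually_elim
        case (elim m)
        have "1 \<le> pochhammer x j" if "1 \<le> x" for x :: real
          using that by (induction j) (auto simp: pochhammer_Suc intro!: mult_ge1_I)
        hence "1 \<le> pochhammer (Re c + real m + 1) j"
          using elim by simp
        hence "Re c + real m \<le> pochhammer (Re c + real m) k"
          using elim by (simp add: Suc pochhammer_rec)
        also have "\<dots> \<le> norm (pochhammer (c + of_nat m) k)"
          using elim by (intro norm_pochhammer_ge) auto
        finally show ?case .
      qed
    qed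
  qed
  have "(\<lambda>m. pochhammer a k * pochhammer b k / fact k / pochhammer (c + of_nat m) k) \<longlonglongrightarrow> 0"
    by (rule tendsto_divide_0[OF tendsto_const c])
  thus ?thesis using Suc by (simp add: hyp_coeff_def field_simps)
qed simp

text \<open>
  Only the term of index \<open>0\<close> survives as the denominator parameter grows.  Tannery's theorem
  applies with the series at a fixed large real parameter as a majorant.
\<close>

lemma hyp_sum_shift_tendsto:
  "(\<lambda>m. \<Sum>k. hyp_coeff a b (c + of_nat m) k) \<longlonglongrightarrow> 1"
proof -
  obtain M :: nat where M: "real M > max (1 - Re c) (Re a + Re b - Re c)"
    using reals_Archimedean2 by blast
  \<comment> \<open>\<open>M\<close> is chosen so that \<open>x\<close> is positive and the series with parameter \<open>x\<close> converges absolutely,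
      even when \<open>a\<close> and \<open>b\<close> make it diverge for \<open>c\<close>.\<close>
  define x where "x = Re c + real M"
  have x: "x > 0" "Re (of_real x - a - b) > 0" using M by (auto simp: x_def)
  have "(\<lambda>m. \<Sum>k. hyp_coeff a b (c + of_nat m) k) \<longlonglongrightarrow> (\<Sum>k. if k = 0 then 1 else 0)"
  proof (rule tannerys_theorem[THEN conjunct2, THEN conjunct2])
    show "(\<lambda>m. hyp_coeff a b (c + of_nat m) k) \<longlonglongrightarrow> (if k = 0 then 1 else 0)" for k
      by (rule hyp_coeff_shift_tendsto)
    have "norm (hyp_coeff a b (c + of_nat m) k) \<le> norm (hyp_coeff a b (of_real x) k)"
      if "m \<ge> M" for m k
    proof -
      have "pochhammer x k \<le> norm (pochhammer (c + of_nat m) k)"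
        using that x by (intro norm_pochhammer_ge) (auto simp: x_def)
      moreover have "pochhammer x k > 0" using x by (intro pochhammer_pos)
      ultimately show ?thesis
        unfolding hyp_coeff_def norm_mult norm_divide pochhammer_of_real norm_of_real
        by (intro divide_left_mono mult_right_mono mult_pos_pos) auto
    qed
    thus "\<forall>\<^sub>F (k, m) in at_top \<times>\<^sub>F sequentially.
            norm (hyp_coeff a b (c + of_nat m) k) \<le> norm (hyp_coeff a b (of_real x) k)"
      unfolding eventually_prod_filter
      by (intro exI[of _ "\<lambda>_. True"] exI[of _ "\<lambda>m. m \<ge> M"]) (auto simp: eventually_ge_at_top)
    have "of_real x \<notin> (\<int>\<^sub>\<le>\<^sub>0 :: complex set)" using x by (auto elim!: nonpos_Ints_cases simp: complex_eq_iff)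
    thus "summable (\<lambda>k. norm (hyp_coeff a b (of_real x) k))"
      using x by (intro hyp_coeff_summable_norm)
  qed auto
  also have "(\<Sum>k. if k = 0 then 1 else 0) = (1::complex)"
    using sums_single[of 0 "\<lambda>_. 1::complex"] by (simp add: sums_iff)
  finally show ?thesis .
qed

text \<open>
  With \<open>F\<close> the sum as a function of \<open>c\<close>, the contiguous relation gives
  \<open>c (c-a-b) F(c) = (c-a) (c-b) F(c+1)\<close>.  Iterated \<open>m + 1\<close> times it produces Pochhammer symbols
  that, because \<open>c + (c-a-b) = (c-a) + (c-b)\<close>, can be normalised on both sides by the same factor
  to terms of \<open>rGamma_series\<close>; then \<open>m\<close> tends to infinity.
\<close>

theorem gauss_summation:
  assumes c: "c \<notin> \<int>\<^sub>\<le>\<^sub>0" and re: "Re (c - a - b) > 0"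
  shows "hyp_coeff a b c sums (Gamma c * Gamma (c - a - b) * rGamma (c - a) * rGamma (c - b))"
proof -
  define F where "F = (\<lambda>c. \<Sum>k. hyp_coeff a b c k)"
  have cm: "c + of_nat m \<notin> \<int>\<^sub>\<le>\<^sub>0" for m
  proof
    assume "c + of_nat m \<in> \<int>\<^sub>\<le>\<^sub>0"
    then obtain k where "c + of_nat m = - of_nat k" by (elim nonpos_Ints_cases')
    hence "c + of_nat (m + k) = 0" by (simp add: add.assoc[symmetric])
    with add_of_nat_neq_0[OF c] show False by blast
  qed
  have sums: "hyp_coeff a b (c + of_nat m) sums F (c + of_nat m)" for m
    unfolding F_def using re
    by (intro summable_sums summable_norm_cancel[OF hyp_coeff_summable_norm] cm) auto
  have step: "w * (w - a - b) * F w = (w - a) * (w - b) * F (w + 1)" if w: "w = c + of_nat m" for w m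
  proof -
    have "(\<lambda>N. w * (w - a - b) * (\<Sum>n<N. hyp_coeff a b w n)) \<longlonglongrightarrow> w * (w - a - b) * F w"
      using sums[of m] unfolding w by (intro tendsto_intros) (simp add: sums_def)
    moreover have "(\<lambda>N. (w - a) * (w - b) * (\<Sum>n<N. hyp_coeff a b (w + 1) n)
                     - w * (of_nat N * hyp_coeff a b w N)) \<longlonglongrightarrow> (w - a) * (w - b) * F (w + 1) - w * 0"
      using sums[of "Suc m"] re unfolding w
      by (intro tendsto_intros of_nat_hyp_coeff_tendsto_0 cm) (auto simp: sums_def algebra_simps)
    ultimately show ?thesis
      using hyp_coeff_contiguous[OF cm[of m, folded w]] LIMSEQ_unique by (simp add: mult.assoc)
  qed
  have iter: "pochhammer c m * pochhammer (c - a - b) m * F c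
                = pochhammer (c - a) m * pochhammer (c - b) m * F (c + of_nat m)" for m
  proof (induction m)
    case (Suc m)
    let ?w = "c + of_nat m"
    have "pochhammer c (Suc m) * pochhammer (c - a - b) (Suc m) * F c
            = (pochhammer c m * pochhammer (c - a - b) m * F c) * (?w * (?w - a - b))"
      by (simp add: pochhammer_Suc mult_ac diff_add_eq)
    also have "\<dots> = pochhammer (c - a) m * pochhammer (c - b) m * (?w * (?w - a - b) * F ?w)"
      unfolding Suc.IH by (simp only: mult_ac)
    also have "\<dots> = pochhammer (c - a) m * pochhammer (c - b) m * ((?w - a) * (?w - b) * F (?w + 1))"
      by (simp only: step[OF refl])
    also have "\<dots> = pochhammer (c - a) (Suc m) * pochhammer (c - b) (Suc m) * F (c + of_nat (Suc m))"
    proof -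
      have "c - a + of_nat m = ?w - a" "c - b + of_nat m = ?w - b" "c + of_nat (Suc m) = ?w + 1"
        by simp_all
      thus ?thesis by (simp only: pochhammer_Suc mult_ac)
    qed
    finally show ?case .
  qed simp
  have "rGamma_series c m * rGamma_series (c - a - b) m * F c
          = rGamma_series (c - a) m * rGamma_series (c - b) m * F (c + of_nat (Suc m))" for m
  proof -
    have "exp (c * z) * exp ((c - a - b) * z) = exp ((c - a) * z) * exp ((c - b) * z)" for z :: complex
      by (simp add: algebra_simps flip: exp_add)
    moreover have "(p / (f * e)) * (q / (f * e')) * x = (p * q * x) / (f * f * (e * e'))"
      for p q e e' f x :: complex by (simp add: mult_ac)
    ultimately show ?thesis using iter[of "Suc m"]
      unfolding rGamma_series_def Suc_eq_plus1 by (simp only:)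
  qed
  moreover have "(\<lambda>m. rGamma_series c m * rGamma_series (c - a - b) m * F c)
                    \<longlonglongrightarrow> rGamma c * rGamma (c - a - b) * F c"
    by (intro tendsto_intros)
  moreover have "(\<lambda>m. rGamma_series (c - a) m * rGamma_series (c - b) m * F (c + of_nat (Suc m)))
                    \<longlonglongrightarrow> rGamma (c - a) * rGamma (c - b) * 1"
    unfolding F_def by (intro tendsto_intros LIMSEQ_Suc hyp_sum_shift_tendsto)
  ultimately have lim: "rGamma c * rGamma (c - a - b) * F c = rGamma (c - a) * rGamma (c - b)"
    using LIMSEQ_unique by fastforce
  have 1: "Gamma c * rGamma c = 1" using c by (simp add: rGamma_inverse_Gamma Gamma_eq_zero_iff)
  have "c - a - b \<notin> \<int>\<^sub>\<le>\<^sub>0" 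
  proof
    assume "c - a - b \<in> \<int>\<^sub>\<le>\<^sub>0"
    then obtain n where "c - a - b = of_int n" "n \<le> 0" by (elim nonpos_Ints_cases)
    hence "Re (c - a - b) \<le> 0" by simp
    with re show False by simp
  qed
  hence 2: "Gamma (c - a - b) * rGamma (c - a - b) = 1" by (simp add: rGamma_inverse_Gamma Gamma_eq_zero_iff)
  have "F c = Gamma c * Gamma (c - a - b) * (rGamma c * rGamma (c - a - b) * F c)"
  proof -
    have "Gamma c * Gamma (c - a - b) * (rGamma c * rGamma (c - a - b) * F c)
            = (Gamma c * rGamma c) * (Gamma (c - a - b) * rGamma (c - a - b)) * F c"
      by (simp only: mult_ac)
    thus ?thesis using 1 2 by simp
  qed
  hence "F c = Gamma c * Gamma (c - a - b) * rGamma (c - a) * rGamma (c - b)"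
    unfolding lim by (simp only: mult.assoc)
  thus ?thesis using sums[of 0] by simp
qed

text \<open>
  Extends Gauss' theorem, multiplied by \<open>c - a - b\<close>, to the strip \<open>-1 < Re (c-a-b) \<le> 0\<close>: the
  correction \<open>N C N\<close> cancels the divergence of the partial sums, and it vanishes in the limit when
  \<open>Re (c-a-b) > 0\<close>.
\<close>

lemma regularised_gauss:
  assumes c: "c \<notin> \<int>\<^sub>\<le>\<^sub>0" and re: "Re (c - a - b) > -1"
  shows "(\<lambda>N. (c - a - b) * (\<Sum>n<N. hyp_coeff a b c n) + of_nat N * hyp_coeff a b c N)
           \<longlonglongrightarrow> Gamma c * Gamma (c - a - b + 1) * rGamma (c - a) * rGamma (c - b)"
proof -
  have c0: "c \<noteq> 0" using c by auto
  have c1: "c + 1 \<notin> \<int>\<^sub>\<le>\<^sub>0"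
    using c plus_one_in_nonpos_Ints_imp by blast
  have "hyp_coeff a b (c + 1) sums
      (Gamma (c + 1) * Gamma (c + 1 - a - b) * rGamma (c + 1 - a) * rGamma (c + 1 - b))"
    using re by (intro gauss_summation c1) auto
  hence "(\<lambda>N. (c - a) * (c - b) / c * (\<Sum>n<N. hyp_coeff a b (c + 1) n)) \<longlonglongrightarrow>
     (c - a) * (c - b) / c * (Gamma (c + 1) * Gamma (c + 1 - a - b) * rGamma (c + 1 - a) * rGamma (c + 1 - b))"
    unfolding sums_def by (intro tendsto_intros)
  also have "(\<lambda>N. (c - a) * (c - b) / c * (\<Sum>n<N. hyp_coeff a b (c + 1) n))
     = (\<lambda>N. (c - a - b) * (\<Sum>n<N. hyp_coeff a b c n) + of_nat N * hyp_coeff a b c N)"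
    using hyp_coeff_contiguous[OF c, of a b] c0 by (auto simp: fun_eq_iff field_simps)
  also have "(c - a) * (c - b) / c * (Gamma (c + 1) * Gamma (c + 1 - a - b) * rGamma (c + 1 - a) * rGamma (c + 1 - b))
     = Gamma c * Gamma (c - a - b + 1) * rGamma (c - a) * rGamma (c - b)"
  proof -
    have "c + 1 - a - b = c - a - b + 1" "c + 1 - a = c - a + 1" "c + 1 - b = c - b + 1"
      by simp_all
    hence "(c - a) * (c - b) / c * (Gamma (c + 1) * Gamma (c + 1 - a - b) * rGamma (c + 1 - a) * rGamma (c + 1 - b))
        = Gamma (c + 1) / c * Gamma (c - a - b + 1)
            * ((c - a) * rGamma (c - a + 1)) * ((c - b) * rGamma (c - b + 1))"
      by (simp only: times_divide_eq_left times_divide_eq_right mult_ac)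
    also have "\<dots> = Gamma c * Gamma (c - a - b + 1) * rGamma (c - a) * rGamma (c - b)"
      unfolding rGamma_plus1 Gamma_plus1[OF c] using c0 by simp
    finally show ?thesis .
  qed
  finally show ?thesis .
qed

section \<open>The telescoping identity between power series\<close>

definition shifted_recip :: "complex \<Rightarrow> complex fps" where
  "shifted_recip w = inverse (fps_const w + fps_X)"

lemma shifted_recip_mult:
  "w \<noteq> 0 \<Longrightarrow> (fps_const w + fps_X) * shifted_recip w = 1"
  unfolding shifted_recip_def by (intro inverse_mult_eq_1') auto

lemma shifted_recip_nth:
  assumes "w \<noteq> 0"
  shows "fps_nth (shifted_recip w) k = (-1) ^ k / w ^ Suc k"
proof -
  have "(fps_const w + fps_X) * Abs_fps (\<lambda>k. (-1) ^ k / w ^ Suc k) = 1"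
  proof (rule fps_ext)
    fix n show "fps_nth ((fps_const w + fps_X) * Abs_fps (\<lambda>k. (-1) ^ k / w ^ Suc k)) n = fps_nth 1 n"
      using assms by (cases n) (auto simp: distrib_right field_simps)
  qed
  hence "Abs_fps (\<lambda>k. (-1) ^ k / w ^ Suc k) = shifted_recip w"
    unfolding shifted_recip_def by (metis fps_inverse_unique mult.commute)
  thus ?thesis by (metis fps_nth_Abs_fps)
qed

definition t_fps :: "complex \<Rightarrow> complex \<Rightarrow> complex fps" where
  "t_fps a b = inverse ((fps_const (2 - a) + fps_X) * (fps_const (2 - b) + fps_X))"

definition r_fps :: "complex \<Rightarrow> complex \<Rightarrow> complex \<Rightarrow> complex fps" where
  "r_fps a b c = t_fps a b * ((1 + fps_X) * (fps_const (2 - c) + fps_X))"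

lemma t_fps_mult:
  assumes "a \<noteq> 2" "b \<noteq> 2"
  shows "t_fps a b * ((fps_const (2 - a) + fps_X) * (fps_const (2 - b) + fps_X)) = 1"
  unfolding t_fps_def using assms by (intro inverse_mult_eq_1) auto

lemma t11_eq_nth:
  assumes "a \<noteq> 2" "b \<noteq> 2"
  shows "t11 a b s = fps_nth (t_fps a b) s"
proof -
  have "(\<lambda>l. inverse ((2 - a + l) * (2 - b + l))) has_fps_expansion t_fps a b"
    unfolding t_fps_def using assms by (intro fps_expansion_intros) auto
  thus ?thesis unfolding t11_def by (simp add: fps_expansion_eqI divide_inverse)
qed

lemma r1_eq_nth:
  assumes "a \<noteq> 2" "b \<noteq> 2"
  shows "r1 a b c s = fps_nth (r_fps a b c) s"
proof -
  have "(\<lambda>l. inverse ((2 - a + l) * (2 - b + l)) * ((1 + l) * (2 - c + l))) has_fps_expansion r_fps a b c"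
    unfolding t_fps_def r_fps_def using assms by (intro fps_expansion_intros) auto
  thus ?thesis unfolding r1_def by (simp add: fps_expansion_eqI divide_inverse mult.commute)
qed

text \<open>
  The algebraic core, with \<open>N\<close> for the index \<open>n\<close>, \<open>X\<close> for \<open>\<lambda>\<close>, and \<open>E2\<close>, \<open>E1\<close>, \<open>T\<close> for the reciprocals
  of \<open>n+2+\<lambda>\<close>, \<open>n+1+\<lambda>\<close> and \<open>(2-a+\<lambda>)(2-b+\<lambda>)\<close>.  It states the partial fraction decompositions
  without division, so that it can be used in the ring of power series.
\<close>

lemma partial_fraction_identity:
  fixes T E2 E1 A B C N X :: "'a :: comm_ring_1"
  assumes "T * ((2 - A + X) * (2 - B + X)) = 1"
    and "(N + 2 + X) * E2 = 1" and "(N + 1 + X) * E1 = 1"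
  shows "E2 - T * ((1 + X) * (2 - C + X)) * E1
           = (A + N) * (B + N) * (T * E2) - N * (C + N - 1) * (T * E1) + (C - A - B) * T"
proof -
  let ?P = "(2 - A + X) * (2 - B + X)" and ?Q = "(1 + X) * (2 - C + X)"
  \<comment> \<open>Division of \<open>?P\<close> by \<open>N + 2 + X\<close>, and of \<open>?Q\<close> by \<open>N + 1 + X\<close>, with remainder.\<close>
  have "?P * E2 = (A + N) * (B + N) * E2 + (X + 2 - N - A - B) * ((N + 2 + X) * E2)"
    by (simp add: algebra_simps)
  hence p: "?P * E2 = (A + N) * (B + N) * E2 + (X + 2 - N - A - B)"
    by (simp only: assms mult_1_right)
  have "?Q * E1 = N * (C + N - 1) * E1 + (X + 2 - N - C) * ((N + 1 + X) * E1)"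
    by (simp add: algebra_simps)
  hence q: "?Q * E1 = N * (C + N - 1) * E1 + (X + 2 - N - C)"
    by (simp only: assms mult_1_right)
  have "?P * E2 - ?Q * E1
      = (A + N) * (B + N) * E2 - N * (C + N - 1) * E1 + (C - A - B)"
    unfolding p q by simp
  moreover have "T * (?P * E2) = E2" using assms(1) by (metis mult.assoc mult_1)
  hence "E2 - T * ?Q * E1 = T * (?P * E2 - ?Q * E1)"
    by (simp only: right_diff_distrib mult.assoc)
  ultimately have "E2 - T * ?Q * E1
      = T * ((A + N) * (B + N) * E2 - N * (C + N - 1) * E1 + (C - A - B))"
    by simp
  thus ?thesis by (simp only: right_diff_distrib distrib_left mult_ac)
qed

lemma of_nat_plus_neq_0:
  "complex_of_nat n + 1 \<noteq> 0" "complex_of_nat n + 2 \<noteq> 0"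
  using of_nat_neq_0[of n, where ?'a = complex] of_nat_neq_0[of "Suc n", where ?'a = complex]
  by (simp_all add: add_ac)

text \<open>
  Multiplied by \<open>C n\<close>, the first two terms on the right are a difference: the recurrence turns
  \<open>C n (a+n) (b+n)\<close> into \<open>C (n+1) (n+1) (c+n)\<close>, the value of \<open>C n n (c+n-1)\<close> at \<open>n + 1\<close>.
\<close>

lemma recip_telescope:
  fixes a b c :: complex and k :: nat
  defines "W \<equiv> \<lambda>n. fps_nth (t_fps a b * shifted_recip (of_nat n + 1)) k"
  assumes ab: "a \<noteq> 2" "b \<noteq> 2"
  shows "fps_nth (shifted_recip (of_nat n + 2)) k
           - fps_nth (r_fps a b c * shifted_recip (of_nat n + 1)) k
         = (a + of_nat n) * (b + of_nat n) * W (Suc n) - of_nat n * (c + of_nat n - 1) * W n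
           + (c - a - b) * fps_nth (t_fps a b) k"
proof -
  let ?E2 = "shifted_recip (of_nat n + 2)" and ?E1 = "shifted_recip (of_nat n + 1)"
  let ?c = "fps_const :: complex \<Rightarrow> complex fps"
  have two: "?c 2 = 2" by (simp add: numeral_fps_const)
  have e2: "(?c (of_nat n) + 2 + fps_X) * ?E2 = 1"
    using shifted_recip_mult[OF of_nat_plus_neq_0(2)[of n]]
    by (simp add: two flip: fps_const_add)
  have e1: "(?c (of_nat n) + 1 + fps_X) * ?E1 = 1"
    using shifted_recip_mult[OF of_nat_plus_neq_0(1)[of n]]
    by (simp flip: fps_const_add)
  have t: "t_fps a b * ((2 - ?c a + fps_X) * (2 - ?c b + fps_X)) = 1"
    using t_fps_mult[OF ab] by (simp add: two flip: fps_const_sub)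
  have "?E2 - r_fps a b c * ?E1
      = (?c a + ?c (of_nat n)) * (?c b + ?c (of_nat n)) * (t_fps a b * ?E2)
        - ?c (of_nat n) * (?c c + ?c (of_nat n) - 1) * (t_fps a b * ?E1) + (?c c - ?c a - ?c b) * t_fps a b"
    using partial_fraction_identity[OF t e2 e1, of "?c c"]
    by (simp add: r_fps_def two flip: fps_const_sub)
  also have "\<dots> = ?c ((a + of_nat n) * (b + of_nat n)) * (t_fps a b * ?E2)
        - ?c (of_nat n * (c + of_nat n - 1)) * (t_fps a b * ?E1) + ?c (c - a - b) * t_fps a b"
    by (simp flip: fps_const_sub fps_const_add fps_const_mult)
  finally have "fps_nth (?E2 - r_fps a b c * ?E1) k = fps_nth \<dots> k" by simp
  moreover have "complex_of_nat (Suc n) + 1 = of_nat n + 2" by simp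
  ultimately show ?thesis
    by (simp only: W_def fps_sub_nth fps_add_nth fps_mult_left_const_nth)
qed

section \<open>Summation\<close>

text \<open>
  Apart from the factor \<open>C N\<close>, the boundary term of the telescoping is \<open>N t k\<close> up to a bounded
  error, with \<open>t k\<close> a coefficient of \<open>t\<close>; subtracting \<open>N t k\<close>, the correction that \<open>regularised_gauss\<close> asks for, leaves a convergent
  sequence.  In terms of \<open>p = 1/(N+1)\<close> this remainder is a polynomial.
\<close>

lemma boundary_term_convergent:
  fixes t :: "complex fps"
  shows "convergent (\<lambda>N. of_nat N * (c + of_nat N - 1) * fps_nth (t * shifted_recip (of_nat N + 1)) k
                        - of_nat N * fps_nth t k)"
proof -
  define p where "p = (\<lambda>N. inverse (complex_of_nat (Suc N)))"
  have p0: "p \<longlonglongrightarrow> 0" unfolding p_def by (intro LIMSEQ_Suc lim_inverse_n)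
  have p: "convergent p" "convergent (\<lambda>N. p N ^ m)" for m
    using convergentI[OF p0] convergentI[OF tendsto_power[OF p0]] by auto
  have eq: "of_nat N * (c + of_nat N - 1) * fps_nth (t * shifted_recip (of_nat N + 1)) k
              - of_nat N * fps_nth t k
      = (\<Sum>s<k. fps_nth t s * (-1) ^ (k - s) * ((1 - p N) * (1 + (c - 2) * p N) * p N ^ (k - s - 1)))
        + fps_nth t k * ((1 - p N) * (c - 2))" for N
  proof -
    let ?w = "complex_of_nat N + 1"
    have w: "?w \<noteq> 0" by (rule of_nat_plus_neq_0)
    have p: "p N = inverse ?w" by (simp add: p_def add.commute)
    have N: "of_nat N = (1 - p N) * ?w" "c + of_nat N - 1 = (1 + (c - 2) * p N) * ?w"
      using w by (simp_all add: p field_simps)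
    have last: "of_nat N * (c + of_nat N - 1) / ?w - of_nat N = (1 - p N) * (c - 2)"
      using w by (simp add: p field_simps)
    have low: "of_nat N * (c + of_nat N - 1) * (fps_nth t s * ((-1) ^ (k - s) / ?w ^ Suc (k - s)))
       = fps_nth t s * (-1) ^ (k - s) * ((1 - p N) * (1 + (c - 2) * p N) * p N ^ (k - s - 1))"
      if "s < k" for s
    proof -
      from that obtain j where j: "k - s = Suc j" by (metis Suc_diff_Suc)
      have "of_nat N * (c + of_nat N - 1) / ?w ^ Suc (Suc j)
              = (1 - p N) * (1 + (c - 2) * p N) * p N ^ j"
      proof -
        have "(x * ?w) * (y * ?w) / ?w ^ Suc (Suc j) = x * y * p N ^ j" for x y
        proof -
          have "(x * ?w) * (y * ?w) / ?w ^ Suc (Suc j) = (x * y * (?w * ?w)) / (?w ^ j * (?w * ?w))"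
            by (simp add: mult_ac)
          also have "\<dots> = x * y / ?w ^ j" using w by (intro nonzero_mult_divide_mult_cancel_right) auto
          also have "\<dots> = x * y * p N ^ j" by (simp add: p power_inverse divide_inverse)
          finally show ?thesis .
        qed
        from this[of "1 - p N" "1 + (c - 2) * p N", folded N] show ?thesis .
      qed
      hence "fps_nth t s * (-1) ^ Suc j * (of_nat N * (c + of_nat N - 1) / ?w ^ Suc (Suc j))
              = fps_nth t s * (-1) ^ Suc j * ((1 - p N) * (1 + (c - 2) * p N) * p N ^ j)"
        by (rule arg_cong)
      thus ?thesis unfolding j diff_Suc_1
        by (simp only: times_divide_eq_left times_divide_eq_right mult_ac)
    qed
    have "fps_nth (t * shifted_recip ?w) k = (\<Sum>s<Suc k. fps_nth t s * ((-1) ^ (k - s) / ?w ^ Suc (k - s)))"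
      by (simp only: fps_mult_nth shifted_recip_nth[OF w] atLeast0AtMost lessThan_Suc_atMost)
    also have "\<dots> = (\<Sum>s<k. fps_nth t s * ((-1) ^ (k - s) / ?w ^ Suc (k - s))) + fps_nth t k / ?w"
      by simp
    finally have nth: "fps_nth (t * shifted_recip ?w) k = \<dots>" .
    have "U * (Y + q / w) - M * q = U * Y + q * (U / w - M)" for U Y q w M :: complex
      by (simp add: algebra_simps)
    hence "of_nat N * (c + of_nat N - 1) * fps_nth (t * shifted_recip ?w) k - of_nat N * fps_nth t k
        = of_nat N * (c + of_nat N - 1) * (\<Sum>s<k. fps_nth t s * ((-1) ^ (k - s) / ?w ^ Suc (k - s)))
          + fps_nth t k * ((1 - p N) * (c - 2))"
      unfolding nth by (simp only: last)
    also have "of_nat N * (c + of_nat N - 1) * (\<Sum>s<k. fps_nth t s * ((-1) ^ (k - s) / ?w ^ Suc (k - s)))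
        = (\<Sum>s<k. fps_nth t s * (-1) ^ (k - s) * ((1 - p N) * (1 + (c - 2) * p N) * p N ^ (k - s - 1)))"
      unfolding sum_distrib_left by (intro sum.cong refl low) simp
    finally show ?thesis .
  qed
  show ?thesis unfolding eq
    by (intro convergent_const convergent_add convergent_sum convergent_mult convergent_diff p)
qed

text \<open>
  The telescoped partial sum splits into \<open>t k\<close> times the sequence of \<open>regularised_gauss\<close> and \<open>C N\<close>
  times a convergent sequence.  For all \<open>k\<close> together the result reads \<open>\<Sum>n. C n (1/(n+2+\<lambda>) - r(\<lambda>)/(n+1+\<lambda>))
  = \<Gamma>(c) \<Gamma>(c-a-b+1) / (\<Gamma>(c-a) \<Gamma>(c-b)) t(\<lambda>)\<close>.
\<close>

theorem hyp_recip_sums: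
  assumes c: "c \<notin> \<int>\<^sub>\<le>\<^sub>0" and re: "Re (c - a - b) > -1" and ab: "a \<noteq> 2" "b \<noteq> 2"
  shows "(\<lambda>n. hyp_coeff a b c n * (fps_nth (shifted_recip (of_nat n + 2)) k
                 - fps_nth (r_fps a b c * shifted_recip (of_nat n + 1)) k))
         sums (Gamma c * Gamma (c - a - b + 1) * rGamma (c - a) * rGamma (c - b) * fps_nth (t_fps a b) k)"
proof -
  let ?C = "hyp_coeff a b c"
  define t where "t = fps_nth (t_fps a b) k"
  define W where "W = (\<lambda>n. fps_nth (t_fps a b * shifted_recip (of_nat n + 1)) k)"
  define S where "S = (\<lambda>N. \<Sum>n<N. ?C n * (fps_nth (shifted_recip (of_nat n + 2)) k
                 - fps_nth (r_fps a b c * shifted_recip (of_nat n + 1)) k))"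
  \<comment> \<open>Telescoped form, with \<open>N t C N\<close> moved from the boundary term to the partial sums so that both
      summands have a limit.\<close>
  have S: "S N = ((c - a - b) * (\<Sum>n<N. ?C n) + of_nat N * ?C N) * t
               + ?C N * (of_nat N * (c + of_nat N - 1) * W N - of_nat N * t)" for N
  proof (induction N)
    case (Suc N)
    have "S (Suc N) = S N + ?C N * ((a + of_nat N) * (b + of_nat N) * W (Suc N)
             - of_nat N * (c + of_nat N - 1) * W N + (c - a - b) * t)"
      unfolding S_def W_def t_def recip_telescope[OF ab] by simp
    also have "\<dots> = S N + (c + of_nat N) * (of_nat N + 1) * ?C (Suc N) * W (Suc N)
             - ?C N * of_nat N * (c + of_nat N - 1) * W N + ?C N * (c - a - b) * t"
      by (simp only: hyp_coeff_Suc[OF c]) (simp add: algebra_simps)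
    finally show ?case unfolding Suc.IH by (simp add: algebra_simps)
  qed (simp add: S_def)
  obtain L where "(\<lambda>N. of_nat N * (c + of_nat N - 1) * W N - of_nat N * t) \<longlonglongrightarrow> L"
    using boundary_term_convergent[of c "t_fps a b" k] unfolding W_def t_def convergent_def by blast
  hence "S \<longlonglongrightarrow> Gamma c * Gamma (c - a - b + 1) * rGamma (c - a) * rGamma (c - b) * t + 0 * L"
    unfolding S by (intro tendsto_intros regularised_gauss hyp_coeff_tendsto_0 c re)
  thus ?thesis by (simp add: sums_def S_def t_def)
qed

text \<open>
  With \<open>k = K - 1\<close>, the coefficient of \<open>\<lambda>^k\<close> in \<open>r(\<lambda>)/(n+1+\<lambda>)\<close> is a sum over \<open>s \<le> k\<close>.  The terms
  \<open>s \<le> K - 2\<close> stay in the series; the last one, \<open>r k / (n+1)\<close>, is summable by itself and gives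
  \<open>A01\<close>.
\<close>

theorem proposition2p8:
  fixes K :: nat and a b c :: complex
  assumes "K \<ge> 2"
    and "c \<notin> \<int>\<^sub>\<le>\<^sub>0"
    and "Re (c - a - b) > -1"
    and "a \<noteq> 2" and "b \<noteq> 2"
  shows "(\<lambda>n. hyp_coeff a b c n *
            (1 / (of_nat n + 2) ^ K
              - (\<Sum>s = 0..K - 2. (-1) ^ s * r1 a b c s / (of_nat n + 1) ^ (K - s))))
         sums
         ((-1) ^ (K - 1) *
            (r1 a b c (K - 1) * A01 a b c
              + Gamma c * Gamma (c - a - b + 1) * rGamma (c - a) * rGamma (c - b)
                * t11 a b (K - 1)))"
proof -
  let ?C = "hyp_coeff a b c" and ?r = "r1 a b c"
  obtain j where K: "K = Suc (Suc j)"
    using assms(1) by (metis add_2_eq_Suc le_Suc_ex)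
  define k where "k = Suc j"
  define D where "D = (\<lambda>n. fps_nth (shifted_recip (of_nat n + 2)) k
                 - fps_nth (r_fps a b c * shifted_recip (of_nat n + 1)) k)"
  have "(\<lambda>n. ?C n * (1 / (of_nat n + 1))) sums A01 a b c"
    unfolding A01_def by (intro summable_sums hyp_coeff_summable_div assms)
  moreover have "(\<lambda>n. ?C n * D n) sums
      (Gamma c * Gamma (c - a - b + 1) * rGamma (c - a) * rGamma (c - b) * t11 a b k)"
    unfolding D_def t11_eq_nth[OF assms(4,5)] by (intro hyp_recip_sums assms)
  ultimately have "(\<lambda>n. (-1) ^ k * (?r k * (?C n * (1 / (of_nat n + 1))) + ?C n * D n)) sums
      ((-1) ^ k * (?r k * A01 a b c
        + Gamma c * Gamma (c - a - b + 1) * rGamma (c - a) * rGamma (c - b) * t11 a b k))"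
    by (intro sums_mult sums_add)
  moreover have "(-1) ^ k * (?r k * (?C n * (1 / (of_nat n + 1))) + ?C n * D n)
      = ?C n * (1 / (of_nat n + 2) ^ K
              - (\<Sum>s = 0..K - 2. (-1) ^ s * ?r s / (of_nat n + 1) ^ (K - s)))" for n
  proof -
    let ?w = "complex_of_nat n + 1"
    have "fps_nth (r_fps a b c * shifted_recip ?w) k
        = (\<Sum>s\<le>k. ?r s * ((-1) ^ (k - s) / ?w ^ Suc (k - s)))"
      by (simp only: fps_mult_nth shifted_recip_nth[OF of_nat_plus_neq_0(1)] atLeast0AtMost
                     r1_eq_nth[OF assms(4,5)])
    also have "(-1) ^ k * \<dots> = (\<Sum>s\<le>k. (-1) ^ s * ?r s / ?w ^ (K - s))"
      unfolding sum_distrib_left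
    proof (rule sum.cong)
      fix s assume s: "s \<in> {..k}"
      hence "(-1) ^ k = (-1) ^ (k - s) * ((-1) ^ s :: complex)" by (simp flip: power_add)
      hence "(-1) ^ k * (-1) ^ (k - s) = ((-1) ^ (k - s) * (-1) ^ (k - s)) * ((-1) ^ s :: complex)"
        by (simp only: mult_ac)
      hence "(-1) ^ k * (-1) ^ (k - s) = ((-1) ^ s :: complex)"
        unfolding minus_one_mult_self by simp
      moreover have "Suc (k - s) = K - s" using s by (auto simp: K k_def)
      moreover have "x * (r * (y / z)) = (x * y) * r / z" for x y r z :: complex by simp
      ultimately show "(-1) ^ k * (?r s * ((-1) ^ (k - s) / ?w ^ Suc (k - s))) = (-1) ^ s * ?r s / ?w ^ (K - s)"
        by (simp only:)
    qed simp
    also have "\<dots> = (\<Sum>s = 0..K - 2. (-1) ^ s * ?r s / ?w ^ (K - s)) + (-1) ^ k * ?r k / ?w"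
      by (simp add: K k_def atLeast0AtMost)
    finally have R: "(-1) ^ k * fps_nth (r_fps a b c * shifted_recip ?w) k = \<dots>" .
    have "(-1) ^ k * fps_nth (shifted_recip (of_nat n + 2)) k = 1 / (of_nat n + 2) ^ K"
      unfolding shifted_recip_nth[OF of_nat_plus_neq_0(2)] by (simp add: K k_def)
    hence "(-1) ^ k * D n + (-1) ^ k * ?r k / ?w
        = 1 / (of_nat n + 2) ^ K - (\<Sum>s = 0..K - 2. (-1) ^ s * ?r s / ?w ^ (K - s))"
      unfolding D_def right_diff_distrib R by (simp only: diff_diff_eq[symmetric] diff_add_cancel)
    moreover have "m * (r * (x * (1 / w)) + x * d) = x * (m * d + m * r / w)" for m r x w d :: complex
      by (simp add: algebra_simps)
    ultimately show ?thesis by (simp only:)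
  qed
  moreover have "K - 1 = k" by (simp add: K k_def)
  ultimately show ?thesis by simp
qed

end
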